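(* Let $\mathcal{X}=(V,S)$ be a Higmanian scheme and let $S=\{s_0,s_1,s_2,s_3,s_4\}$ be a standard ordering of $S$, with nontrivial parabolics $e_0=s_0\cup s_1$ and $e_1=s_0\cup s_1\cup s_2$. Let $i\in\{3,4\}$ and let $\Gamma$ be the graph with vertex set $V$ and edge set $E=s_2\cup s_i$. Then $\Gamma$ is a divisible design graph if and only if $c_{33}^3=c_{33}^4$ and at least one of the following two equalities holds: $$\text{(A)}\quad \frac{1}{n_3}+\frac{1}{n_4}=\frac{1}{n_1}-\frac{1}{n_1+1};\qquad\qquad \text{(B)}\quad \frac{n_2}{n_1+1}-\frac{2n_i}{n_{7-i}}=1.$$ Moreover, the canonical partition of $\Gamma$ is the partition of $V$ into the classes of $e_1$ whenever (A) holds, and into the classes of $e_0$ whenever (B) holds; and $\Gamma$ is a proper divisible design graph if and only if exactly one of (A) and (B) holds.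
   Context: An association scheme on a finite set $V$ is a pair $\mathcal{X}=(V,S)$, where $S$ is a partition of $V^2$ such that the diagonal $\mathbf{1}_V=\{(x,x):x\in V\}$ belongs to $S$, $s^*=\{(y,x):(x,y)\in s\}\in S$ for all $s\in S$, and for all $r,s,t\in S$ the number $c_{rs}^t=|xr\cap ys^*|$ (where $xr=\{y:(x,y)\in r\}$) does not depend on the choice of $(x,y)\in t$. Elements of $S$ are called basis relations. The valency of a union $r$ of basis relations is $n_r=|xr|$ (independent of $x\in V$). A parabolic is an equivalence relation on $V$ which is a union of basis relations. For a relation $s\subseteq V^2$, $\mathrm{rad}(s)$ denotes the largest relation $r\subseteq V^2$ with $rs=sr=s$ (composition of relations). The scheme $\mathcal{X}$ is Higmanian if: $|S|=5$; $s^*=s$ for every $s\in S$; there exist $s_1,s_2\in S$ such that $e_0=\mathbf{1}_V\cup s_1$ and $e_1=\mathbf{1}_V\cup s_1\cup s_2$ are parabolics; and $\mathrm{rad}(s)=\mathbf{1}_V$ for every $s\in S$ not contained in $e_1$. (Then $e_0,e_1$ are the only parabolics other than $\mathbf{1}_V$ and $V^2$.) A standard ordering of $S$ is $S=\{s_0,\dots,s_4\}$ with $s_0=\mathbf{1}_V$, $s_1=e_0\setminus\mathbf{1}_V$, $s_2=e_1\setminus e_0$, and $n_3\le n_4$, where $n_j=n_{s_j}$; write $c_{jk}^l=c_{s_js_k}^{s_l}$. Graphs are simple, undirected, loopless. A regular graph $\Gamma$ of degree $k$ on a vertex set of size $v$ is a divisible design graph (DDG) with parameters $(v,k,\lambda_1,\lambda_2,m,n)$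 if its vertex set can be partitioned into $m$ classes, each of size $n$, such that any two distinct vertices in the same class have exactly $\lambda_1$ common neighbours and any two vertices in different classes have exactly $\lambda_2$ common neighbours; such a partition is called the canonical partition. A DDG is proper if $m,n>1$ and $\lambda_1\neq\lambda_2$.
   Formalization: The "Moreover" claims are stated for Γ a divisible design graph: without c_33^3=c_33^4, exactly one of (A), (B) can hold with Γ not a DDG (e.g. the 24-cell scheme). Uniqueness of the canonical partition is asserted only when Γ is proper, since if (A) and (B) both hold it is not unique. *)

theory Defs
  imports Complex_Main "HOL-Library.Disjoint_Sets" "Graph_Theory.Pair_Digraph"
begin

section \<open>Association schemes\<close>

text \<open>For \<open>(x, y)\<close> in \<open>t\<close>, the set \<open>xr \<inter> ys\<^sup>*\<close> is \<open>r `` {x} \<inter> s\<inverse> `` {y}\<close>.\<close>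

definition association_scheme :: "'a set \<Rightarrow> 'a rel set \<Rightarrow> bool" where
  "association_scheme V S \<longleftrightarrow>
     finite V \<and> partition_on (V \<times> V) S \<and> Id_on V \<in> S \<and> (\<forall>s\<in>S. s\<inverse> \<in> S) \<and>
     (\<forall>r\<in>S. \<forall>s\<in>S. \<forall>t\<in>S. \<exists>c. \<forall>(x, y)\<in>t. card (r `` {x} \<inter> s\<inverse> `` {y}) = c)"

text \<open>The next two definitions are meaningful for basis relations of an association scheme
  (respectively unions of basis relations), where the described number exists and is unique.\<close>

definition intersection_number :: "'a rel \<Rightarrow> 'a rel \<Rightarrow> 'a rel \<Rightarrow> nat" where
  "intersection_number r s t = (THE c. \<forall>(x, y)\<in>t. card (r `` {x} \<inter> s\<inverse> `` {y}) = c)"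

definition valency :: "'a set \<Rightarrow> 'a rel \<Rightarrow> nat" where
  "valency V r = (THE n. \<forall>x\<in>V. card (r `` {x}) = n)"

definition parabolic :: "'a set \<Rightarrow> 'a rel set \<Rightarrow> 'a rel \<Rightarrow> bool" where
  "parabolic V S e \<longleftrightarrow> equiv V e \<and> (\<exists>T\<subseteq>S. e = \<Union>T)"

definition rad :: "'a set \<Rightarrow> 'a rel \<Rightarrow> 'a rel" where
  "rad V s = \<Union>{r. r \<subseteq> V \<times> V \<and> r O s = s \<and> s O r = s}"

text \<open>The union above is itself a relation of the required kind, hence the largest one.\<close>

lemma rad_greatest:
  assumes "s \<subseteq> V \<times> V"
  shows "rad V s \<subseteq> V \<times> V \<and> rad V s O s = s \<and> s O rad V s = s"
    and "r \<subseteq> V \<times> V \<Longrightarrow> r O s = s \<Longrightarrow> s O r = s \<Longrightarrow> r \<subseteq> rad V s"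
proof -
  let ?R = "{r. r \<subseteq> V \<times> V \<and> r O s = s \<and> s O r = s}"
  have ne: "Id_on V \<in> ?R"
    using assms by auto
  have "\<Union>?R O s = (\<Union>r\<in>?R. r O s)" "s O \<Union>?R = (\<Union>r\<in>?R. s O r)"
    by blast+
  moreover have "(\<Union>r\<in>?R. r O s) = (\<Union>r\<in>?R. s)" "(\<Union>r\<in>?R. s O r) = (\<Union>r\<in>?R. s)"
    by (rule SUP_cong; simp)+
  moreover have "(\<Union>r\<in>?R. s) = s"
    using ne by blast
  ultimately show "rad V s \<subseteq> V \<times> V \<and> rad V s O s = s \<and> s O rad V s = s"
    unfolding rad_def by auto
qed (auto simp: rad_def)

section \<open>Higmanian schemes\<close>

text \<open>The pair \<open>s1\<close>, \<open>s2\<close> witnesses the existential part of the definition of a Higmanian scheme.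
  The relations \<open>1\<^sub>V\<close>, \<open>s1\<close>, \<open>s2\<close> are pairwise distinct, i.e. \<open>1\<^sub>V \<subset> e0 \<subset> e1\<close>.\<close>

definition higmanian_pair :: "'a set \<Rightarrow> 'a rel set \<Rightarrow> 'a rel \<Rightarrow> 'a rel \<Rightarrow> bool" where
  "higmanian_pair V S s1 s2 \<longleftrightarrow>
     s1 \<in> S \<and> s2 \<in> S \<and> distinct [Id_on V, s1, s2] \<and>
     parabolic V S (Id_on V \<union> s1) \<and>
     parabolic V S (Id_on V \<union> s1 \<union> s2) \<and>
     (\<forall>s\<in>S. \<not> s \<subseteq> Id_on V \<union> s1 \<union> s2 \<longrightarrow> rad V s = Id_on V)"

definition higmanian :: "'a set \<Rightarrow> 'a rel set \<Rightarrow> bool" where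
  "higmanian V S \<longleftrightarrow>
     association_scheme V S \<and> card S = 5 \<and> (\<forall>s\<in>S. s\<inverse> = s) \<and> (\<exists>s1 s2. higmanian_pair V S s1 s2)"

text \<open>Only the values \<open>s 0, \<dots>, s 4\<close> matter. In a Higmanian scheme they are pairwise
  distinct because \<open>card S = 5\<close>.\<close>

definition standard_ordering :: "'a set \<Rightarrow> 'a rel set \<Rightarrow> (nat \<Rightarrow> 'a rel) \<Rightarrow> bool" where
  "standard_ordering V S s \<longleftrightarrow>
     S = s ` {0..4} \<and> s 0 = Id_on V \<and> higmanian_pair V S (s 1) (s 2) \<and>
     valency V (s 3) \<le> valency V (s 4)"

section \<open>Divisible design graphs\<close>

text \<open>The locale \<^locale>\<open>pair_graph\<close> describes finite simple undirected loopless graphs; an edge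
  between \<open>x\<close> and \<open>y\<close> is represented by the two arcs \<open>(x, y)\<close> and \<open>(y, x)\<close>.\<close>

definition common_neighbours :: "'a pair_pre_digraph \<Rightarrow> 'a \<Rightarrow> 'a \<Rightarrow> 'a set" where
  "common_neighbours G x y = {z. (x, z) \<in> parcs G \<and> (y, z) \<in> parcs G}"

definition divisible_design ::
    "'a pair_pre_digraph \<Rightarrow> 'a set set \<Rightarrow> nat \<Rightarrow> nat \<Rightarrow> nat \<Rightarrow> nat \<Rightarrow> nat \<Rightarrow> nat \<Rightarrow> bool" where
  "divisible_design G P v k l1 l2 m n \<longleftrightarrow>
     pair_graph G \<and> card (pverts G) = v \<and> (\<forall>x\<in>pverts G. out_degree (with_proj G) x = k) \<and>
     partition_on (pverts G) P \<and> card P = m \<and> (\<forall>C\<in>P. card C = n) \<and>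
     (\<forall>C\<in>P. \<forall>x\<in>C. \<forall>y\<in>C. x \<noteq> y \<longrightarrow> card (common_neighbours G x y) = l1) \<and>
     (\<forall>C\<in>P. \<forall>D\<in>P. C \<noteq> D \<longrightarrow> (\<forall>x\<in>C. \<forall>y\<in>D. card (common_neighbours G x y) = l2))"

definition canonical_partition :: "'a pair_pre_digraph \<Rightarrow> 'a set set \<Rightarrow> bool" where
  "canonical_partition G P \<longleftrightarrow> (\<exists>v k l1 l2 m n. divisible_design G P v k l1 l2 m n)"

definition DDG :: "'a pair_pre_digraph \<Rightarrow> bool" where
  "DDG G \<longleftrightarrow> (\<exists>P v k l1 l2 m n. divisible_design G P v k l1 l2 m n)"

definition proper_DDG :: "'a pair_pre_digraph \<Rightarrow> bool" where
  "proper_DDG G \<longleftrightarrow>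
     (\<exists>P v k l1 l2 m n. divisible_design G P v k l1 l2 m n \<and> m > 1 \<and> n > 1 \<and> l1 \<noteq> l2)"

end

theory Submission
  imports Defs
begin

text \<open>The number \<open>lam l\<close> of common neighbours of two vertices depends only on the basis relation
  \<open>s l\<close> containing them. As \<open>s 3\<close> and \<open>s 4\<close> are not unions of blocks of \<open>e0\<close>, each of them is
  equidistributed over the parabolic classes met by it, and double counting yields
  \<open>lam 1, \<dots>, lam 4\<close> in terms of the valencies and \<open>c\<^sub>i\<^sub>i\<^sup>3, c\<^sub>i\<^sub>i\<^sup>4\<close>. Then (A) says
  \<open>lam 1 = lam 2\<close>, and (B) says \<open>lam 2 = lam 3\<close> provided \<open>lam 3 = lam 4\<close>. Conversely, unless all
  \<open>lam l\<close> agree, the classes of a canonical partition are those of a parabolic, hence of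
  \<open>e0\<close> or \<open>e1\<close>.\<close>

section \<open>Symmetric association schemes\<close>

locale symmetric_scheme =
  fixes V :: "'a set" and S :: "'a rel set"
  assumes scheme: "association_scheme V S"
    and sym: "r \<in> S \<Longrightarrow> r\<inverse> = r"
begin

section \<open>Basis relations, valencies and intersection numbers\<close>

lemma finite_V: "finite V"
  and partition: "partition_on (V \<times> V) S"
  and Id_on_mem: "Id_on V \<in> S"
  using scheme by (auto simp: association_scheme_def)

lemma finite_S: "finite S"
  using partition finite_V by (meson finite_SigmaI finite_elements)

lemma in_V:
  assumes "r \<in> S" "(x, y) \<in> r" shows "x \<in> V" "y \<in> V"
  using assms partition by (auto simp: partition_on_def)

lemma finite_basis: "r \<in> S \<Longrightarrow> finite r"
  using finite_V in_V by (meson SigmaI finite_SigmaI finite_subset subrelI)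

lemma finite_Image: "r \<in> S \<Longrightarrow> finite (r `` {x})"
  by (rule finite_subset[OF _ finite_V]) (auto dest: in_V)

lemma symD: "r \<in> S \<Longrightarrow> (x, y) \<in> r \<Longrightarrow> (y, x) \<in> r"
  using sym by blast

lemma basis_nonempty:
  assumes "r \<in> S" obtains x y where "(x, y) \<in> r" "x \<in> V" "y \<in> V"
proof -
  have "r \<noteq> {}" using assms partition by (auto simp: partition_on_def)
  then show thesis using assms in_V that by (metis ex_in_conv surj_pair)
qed

lemma basis_eqI: "r \<in> S \<Longrightarrow> t \<in> S \<Longrightarrow> z \<in> r \<Longrightarrow> z \<in> t \<Longrightarrow> r = t"
  using partition by (auto simp: partition_on_def disjoint_def)

text \<open>Since \<open>t\<close> is nonempty, the constant given by the axiom is unique; symmetry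
  of \<open>s\<close> removes the converse.\<close>

lemma intersection_number_eq:
  assumes "r \<in> S" "s \<in> S" "t \<in> S" "(x, y) \<in> t"
  shows "card (r `` {x} \<inter> s `` {y}) = intersection_number r s t"
proof -
  obtain c where c: "\<forall>(x, y)\<in>t. card (r `` {x} \<inter> s\<inverse> `` {y}) = c"
    using scheme assms unfolding association_scheme_def by meson
  then have "intersection_number r s t = c"
    unfolding intersection_number_def using assms(4) by (intro the_equality) auto
  then show ?thesis using c assms sym by auto
qed

text \<open>At a diagonal pair the set counted by an intersection number of \<open>r\<close> with
  itself is the whole image of the point under \<open>r\<close>, so the valency is one of the
  intersection numbers.\<close>

lemma valency_eq:
  assumes "r \<in> S" "x \<in> V" shows "card (r `` {x}) = valency V r"
proof -
  have c: "card (r `` {y}) = intersection_number r r (Id_on V)" if "y \<in> V" for y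
    using intersection_number_eq[OF assms(1) assms(1) Id_on_mem, of y y] that by auto
  then have "valency V r = intersection_number r r (Id_on V)"
    unfolding valency_def using assms by (intro the_equality) auto
  then show ?thesis using c assms by simp
qed

lemma valency_pos:
  assumes "r \<in> S" shows "valency V r > 0"
proof -
  obtain x y where xy: "(x, y) \<in> r" "x \<in> V" using basis_nonempty[OF assms] by metis
  then have "card (r `` {x}) > 0" using finite_Image[OF assms] by (auto simp: card_gt_0_iff)
  then show ?thesis using valency_eq assms xy by simp
qed

lemma intersection_number_commute:
  assumes "r \<in> S" "s \<in> S" "t \<in> S"
  shows "intersection_number r s t = intersection_number s r t"
proof -
  obtain x y where "(x, y) \<in> t" using basis_nonempty[OF assms(3)] by metis
  then show ?thesis
    using intersection_number_eq[OF assms] intersection_number_eq[OF assms(2,1,3)] symD[OF assms(3)]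
    by (metis Int_commute)
qed

text \<open>The relations in \<open>T\<close> are disjoint, so the count splits. If
  \<open>\<Union>T\<close> is a parabolic, the left side depends on \<open>y\<close> only through
  its class.\<close>

lemma card_Image_Int_Image:
  assumes "r \<in> S" "T \<subseteq> S" "t \<in> S" "(x, y) \<in> t"
  shows "card (r `` {x} \<inter> \<Union>T `` {y}) = (\<Sum>s\<in>T. intersection_number r s t)"
proof -
  have "r `` {x} \<inter> \<Union>T `` {y} = (\<Union>s\<in>T. r `` {x} \<inter> s `` {y})" by auto
  also have "card \<dots> = (\<Sum>s\<in>T. card (r `` {x} \<inter> s `` {y}))"
  proof (rule card_UN_disjoint)
    show "finite T" using assms finite_S finite_subset by blast
    show "\<forall>s\<in>T. finite (r `` {x} \<inter> s `` {y})" using finite_Image assms by auto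
    show "\<forall>s\<in>T. \<forall>s'\<in>T. s \<noteq> s' \<longrightarrow> r `` {x} \<inter> s `` {y} \<inter> (r `` {x} \<inter> s' `` {y}) = {}"
    proof (intro ballI impI)
      fix s s' assume "s \<in> T" "s' \<in> T" "s \<noteq> s'"
      then have "s \<inter> s' = {}" using assms(2) basis_eqI by blast
      then show "r `` {x} \<inter> s `` {y} \<inter> (r `` {x} \<inter> s' `` {y}) = {}" by blast
    qed
  qed
  also have "\<dots> = (\<Sum>s\<in>T. intersection_number r s t)"
    using assms by (intro sum.cong) (auto intro: intersection_number_eq)
  finally show ?thesis .
qed

lemma sum_intersection_number:
  assumes "r \<in> S" "t \<in> S"
  shows "(\<Sum>s\<in>S. intersection_number r s t) = valency V r"
proof -
  obtain x y where xy: "(x, y) \<in> t" "x \<in> V" "y \<in> V" using basis_nonempty[OF assms(2)] by metis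
  have "r `` {x} \<inter> \<Union>S `` {y} = r `` {x}"
    using xy in_V[OF assms(1)] partition by (auto simp: partition_on_def)
  then show ?thesis
    using card_Image_Int_Image[of r S t x y] valency_eq assms xy by simp
qed

section \<open>Double counting of triangles\<close>

lemma card_basis:
  assumes "r \<in> S" shows "card r = card V * valency V r"
proof -
  have "r = (SIGMA x:V. r `` {x})" using in_V[OF assms] by auto
  then have "card r = (\<Sum>x\<in>V. card (r `` {x}))"
    using card_SigmaI finite_V finite_Image[OF assms] by metis
  then show ?thesis using valency_eq assms by simp
qed

text \<open>Both sides, multiplied by \<open>|V|\<close>, count the triangles with sides in \<open>r\<close>, \<open>s\<close>, \<open>t\<close>.\<close>

lemma valency_mult_intersection_number:
  assumes "r \<in> S" "s \<in> S" "t \<in> S"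
  shows "valency V t * intersection_number r s t = valency V r * intersection_number s t r"
proof -
  define X where "X = (SIGMA p:t. r `` {fst p} \<inter> s `` {snd p})"
  define Y where "Y = (SIGMA p:r. s `` {snd p} \<inter> t `` {fst p})"
  have "bij_betw (\<lambda>((x, y), z). ((x, z), y)) X Y"
    using symD[OF assms(1)] symD[OF assms(2)] symD[OF assms(3)]
    by (intro bij_betw_byWitness[where f' = "\<lambda>((x, y), z). ((x, z), y)"])
      (auto simp: X_def Y_def)
  then have "card X = card Y" by (rule bij_betw_same_card)
  moreover have "card X = card t * intersection_number r s t"
  proof -
    have "card X = (\<Sum>p\<in>t. card (r `` {fst p} \<inter> s `` {snd p}))"
      unfolding X_def using assms finite_basis finite_Image by (intro card_SigmaI) auto
    also have "\<dots> = (\<Sum>p\<in>t. intersection_number r s t)"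
      using assms by (intro sum.cong refl intersection_number_eq) auto
    finally show ?thesis by simp
  qed
  moreover have "card Y = card r * intersection_number s t r"
  proof -
    have "card Y = (\<Sum>p\<in>r. card (s `` {snd p} \<inter> t `` {fst p}))"
      unfolding Y_def using assms finite_basis finite_Image by (intro card_SigmaI) auto
    also have "\<dots> = (\<Sum>p\<in>r. intersection_number s t r)"
      using assms symD by (intro sum.cong refl intersection_number_eq) auto
    finally show ?thesis by simp
  qed
  moreover have "card V > 0"
    using basis_nonempty[OF assms(1)] finite_V by (metis card_gt_0_iff emptyE)
  ultimately have "card V * (valency V t * intersection_number r s t) =
      card V * (valency V r * intersection_number s t r)" "card V \<noteq> 0"
    using card_basis assms by (simp_all add: mult.assoc)
  then show ?thesis by simp
qed

lemma intersection_number_pos_iff: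
  assumes "r \<in> S" "s \<in> S" "t \<in> S" "(x, y) \<in> t"
  shows "intersection_number r s t > 0 \<longleftrightarrow> (\<exists>z. (x, z) \<in> r \<and> (z, y) \<in> s)"
proof -
  have "intersection_number r s t > 0 \<longleftrightarrow> r `` {x} \<inter> s `` {y} \<noteq> {}"
    using finite_Image[OF assms(1), of x]
    unfolding intersection_number_eq[OF assms, symmetric] by (simp add: card_gt_0_iff)
  then show ?thesis using symD[OF assms(2)] by blast
qed

end

section \<open>Intersection numbers of a Higmanian scheme\<close>

locale higmanian_scheme =
  fixes V :: "'a set" and S :: "'a rel set" and s :: "nat \<Rightarrow> 'a rel"
  assumes higmanian: "higmanian V S"
    and ordering: "standard_ordering V S s"

sublocale higmanian_scheme \<subseteq> symmetric_scheme V S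
  using higmanian by unfold_locales (auto simp: higmanian_def)

context higmanian_scheme
begin

text \<open>Real values let the counts be subtracted and divided without truncation.\<close>

abbreviation n :: "nat \<Rightarrow> real"
  where "n j \<equiv> real (valency V (s j))"

abbreviation p :: "nat \<Rightarrow> nat \<Rightarrow> nat \<Rightarrow> real"
  where "p j k l \<equiv> real (intersection_number (s j) (s k) (s l))"

abbreviation e0 :: "'a rel" where "e0 \<equiv> s 0 \<union> s 1"
abbreviation e1 :: "'a rel" where "e1 \<equiv> s 0 \<union> s 1 \<union> s 2"

section \<open>Indexed relations and the chain of parabolics\<close>

lemma S_eq: "S = s ` {0..4}"
  and s_0: "s 0 = Id_on V"
  and pair: "higmanian_pair V S (s 1) (s 2)"
  using ordering by (auto simp: standard_ordering_def)

lemma inj_s: "inj_on s {0..4}"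
  using S_eq higmanian by (intro eq_card_imp_inj_on) (auto simp: higmanian_def)

lemma s_mem [simp]: "j \<le> 4 \<Longrightarrow> s j \<in> S"
  using S_eq by auto

lemma equiv_e0: "equiv V e0" and equiv_e1: "equiv V e1"
  using pair s_0 by (auto simp: higmanian_pair_def parabolic_def)

lemma sum_S: "(\<Sum>r\<in>S. f r) = f (s 0) + f (s 1) + f (s 2) + f (s 3) + f (s 4)"
proof -
  have "{0..4} = {0, 1, 2, 3, 4::nat}" by auto
  then show ?thesis using sum.reindex[OF inj_s, of f] S_eq by (simp add: add.assoc)
qed

lemma s_unique: "(x, y) \<in> s j \<Longrightarrow> (x, y) \<in> s k \<Longrightarrow> j \<le> 4 \<Longrightarrow> k \<le> 4 \<Longrightarrow> j = k"
  using inj_onD[OF inj_s, of j k] basis_eqI[of "s j" "s k" "(x, y)"] by simp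

lemma s_mem_iff: "(x, y) \<in> s j \<Longrightarrow> j \<le> 4 \<Longrightarrow> k \<le> 4 \<Longrightarrow> (x, y) \<in> s k \<longleftrightarrow> j = k"
  using s_unique by blast

lemma s_exists:
  assumes "x \<in> V" "y \<in> V" obtains j where "j \<le> 4" "(x, y) \<in> s j"
proof -
  have "(x, y) \<in> \<Union>S" using assms partition by (auto simp: partition_on_def)
  then show thesis using that S_eq by auto
qed

lemma s_sym: "j \<le> 4 \<Longrightarrow> (x, y) \<in> s j \<Longrightarrow> (y, x) \<in> s j"
  using symD by simp

lemma in_e0_iff: "(x, y) \<in> s j \<Longrightarrow> j \<le> 4 \<Longrightarrow> (x, y) \<in> e0 \<longleftrightarrow> j \<le> 1"
  by (auto simp: s_mem_iff[of x y j] le_Suc_eq)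

lemma in_e1_iff: "(x, y) \<in> s j \<Longrightarrow> j \<le> 4 \<Longrightarrow> (x, y) \<in> e1 \<longleftrightarrow> j \<le> 2"
  by (auto simp: s_mem_iff[of x y j] le_Suc_eq numeral_2_eq_2)

text \<open>The level \<open>min l 3\<close> of a pair in \<open>s l\<close> is 0, 1, 2 or 3
  according to the smallest of the diagonal, \<open>e0\<close>, \<open>e1\<close> and
  \<open>V \<times> V\<close> that contains it. Transitivity of these relations makes the level an
  ultrametric.\<close>

lemma ultrametric:
  assumes "(x, y) \<in> s j" "(y, z) \<in> s k" "(x, z) \<in> s l" "j \<le> 4" "k \<le> 4" "l \<le> 4"
  shows "min l 3 \<le> max (min j 3) (min k 3)"
proof -
  have "l \<le> 2" if "j \<le> 2" "k \<le> 2"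
    using that assms in_e1_iff[OF assms(1)] in_e1_iff[OF assms(2)] in_e1_iff[OF assms(3)]
      equiv_e1 by (meson equivE transE)
  moreover have "l \<le> 1" if "j \<le> 1" "k \<le> 1"
    using that assms in_e0_iff[OF assms(1)] in_e0_iff[OF assms(2)] in_e0_iff[OF assms(3)]
      equiv_e0 by (meson equivE transE)
  moreover have "l = 0" if "j = 0" "k = 0"
    using that assms s_unique[of x z 0 l] s_0 by auto
  ultimately show ?thesis by linarith
qed

text \<open>In an ultrametric triangle the largest level occurs at least twice; the last hypothesis
  lets it occur only once.\<close>

lemma p_eq_0:
  assumes "j \<le> 4" "k \<le> 4" "l \<le> 4"
    and "max (min j 3) (min k 3) < min l 3 \<or> max (min j 3) (min l 3) < min k 3 \<or>
      max (min k 3) (min l 3) < min j 3"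
  shows "p j k l = 0"
proof (rule ccontr)
  assume "p j k l \<noteq> 0"
  moreover obtain x y where xy: "(x, y) \<in> s l" using basis_nonempty[of "s l"] assms(3) by force
  ultimately obtain z where "(x, z) \<in> s j" "(z, y) \<in> s k"
    using intersection_number_pos_iff[of "s j" "s k" "s l" x y] assms by auto
  then have xz: "(x, z) \<in> s j" "(z, x) \<in> s j" and zy: "(z, y) \<in> s k" and yx: "(y, x) \<in> s l"
    using s_sym assms xy by auto
  have "min l 3 \<le> max (min j 3) (min k 3)" "min k 3 \<le> max (min j 3) (min l 3)"
    "min j 3 \<le> max (min k 3) (min l 3)"
    by (rule ultrametric[OF xz(1) zy xy] ultrametric[OF xz(2) xy zy] ultrametric[OF zy yx xz(2)];
      fact)+
  then show False using assms(4) leD by blast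
qed

section \<open>Identities for the numbers \<open>p j k l\<close>\<close>

lemma p_commute: "j \<le> 4 \<Longrightarrow> k \<le> 4 \<Longrightarrow> l \<le> 4 \<Longrightarrow> p j k l = p k j l"
  using intersection_number_commute[of "s j" "s k" "s l"] by simp

lemma p_rotate: "j \<le> 4 \<Longrightarrow> k \<le> 4 \<Longrightarrow> l \<le> 4 \<Longrightarrow> n l * p j k l = n j * p k l j"
  using valency_mult_intersection_number[of "s j" "s k" "s l"] by (simp flip: of_nat_mult)

lemma p_sum: "j \<le> 4 \<Longrightarrow> l \<le> 4 \<Longrightarrow> p j 0 l + p j 1 l + p j 2 l + p j 3 l + p j 4 l = n j"
  using sum_intersection_number[of "s j" "s l"] by (simp add: sum_S flip: of_nat_add)

lemma n_pos: "j \<le> 4 \<Longrightarrow> n j > 0"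
  using valency_pos by simp

lemma p_0:
  assumes "j \<le> 4" "l \<le> 4" shows "p j 0 l = (if j = l then 1 else 0)"
proof -
  obtain x y where xy: "(x, y) \<in> s l" using basis_nonempty[of "s l"] assms by force
  have "card (s j `` {x} \<inter> s 0 `` {y}) = intersection_number (s j) (s 0) (s l)"
    using intersection_number_eq[of "s j" "s 0" "s l" x y] assms xy by simp
  moreover have "s j `` {x} \<inter> s 0 `` {y} = (if j = l then {y} else {})"
  proof -
    have "x \<in> V" "y \<in> V" using xy assms in_V[of "s l"] by auto
    moreover from this have "s 0 `` {y} = {y}" by (auto simp: s_0)
    ultimately show ?thesis using s_mem_iff[OF xy, of j] assms by auto
  qed
  ultimately show ?thesis by (cases "j = l") simp_all
qed

text \<open>Otherwise \<open>s 3\<close> would be a union of blocks of \<open>e0\<close>, and its radical would contain \<open>e0\<close>.\<close>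

lemma rad_witness: "\<exists>x y z. (x, y) \<in> s 3 \<and> (y, z) \<in> s 1 \<and> (x, z) \<in> s 4"
proof (rule ccontr)
  assume "\<not> ?thesis"
  then have no: "(x, z) \<notin> s 4" if "(x, y) \<in> s 3" "(y, z) \<in> s 1" for x y z
    using that by blast
  have step: "(x, z) \<in> s 3" if xy: "(x, y) \<in> s 3" and yz: "(y, z) \<in> e0" for x y z
  proof -
    have "x \<in> V" "z \<in> V" using xy yz in_V[of "s 3" x y] equiv_e0 in_V[of "s 0"] in_V[of "s 1"] by auto
    then obtain l where l: "l \<le> 4" "(x, z) \<in> s l" using s_exists by metis
    obtain j where j: "j \<le> 1" "(y, z) \<in> s j" using yz by auto
    \<comment> \<open>The pair \<open>(x, y)\<close> has level 3 and \<open>(y, z)\<close> has level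
      at most 1, so \<open>(x, z)\<close> has level 3 as well.\<close>
    have "l \<ge> 3"
      using ultrametric[of x z l y j 3] l j xy s_sym[of j y z] by auto
    moreover have "l \<noteq> 4" using no[OF xy, of z] l j s_0 xy s_unique[of x y 3 4]
      by (cases "j = 0") (auto simp: le_Suc_eq)
    ultimately show ?thesis using l by (simp add: le_Suc_eq numeral_eq_Suc)
  qed
  have e0_sym: "(x, y) \<in> e0 \<Longrightarrow> (y, x) \<in> e0" for x y using s_sym[of 0] s_sym[of 1] by auto
  have step': "(x, z) \<in> s 3" if "(x, y) \<in> e0" "(y, z) \<in> s 3" for x y z
    using s_sym[OF _ step[OF s_sym[OF _ that(2)] e0_sym[OF that(1)]]] by simp
  have ends: "(x, x) \<in> s 0" "(y, y) \<in> s 0" if "(x, y) \<in> s 3" for x y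
    using that in_V[of "s 3" x y] by (auto simp: s_0)
  have sub: "s 3 O e0 \<subseteq> s 3" "e0 O s 3 \<subseteq> s 3"
    using step step' by blast+
  have sup: "p \<in> s 3 O e0" "p \<in> e0 O s 3" if "p \<in> s 3" for p
    using that ends[of "fst p" "snd p"] by (cases p; auto)+
  have "s 3 \<subseteq> V \<times> V" "e0 \<subseteq> V \<times> V"
    using in_V[of "s 0"] in_V[of "s 1"] in_V[of "s 3"] by auto
  then have "e0 \<subseteq> rad V (s 3)"
    by (rule rad_greatest(2)[OF _ _ subset_antisym[OF sub(2) subsetI[OF sup(2)]]
          subset_antisym[OF sub(1) subsetI[OF sup(1)]]])
  moreover obtain x y where xy: "(x, y) \<in> s 3" using basis_nonempty[of "s 3"] by force
  then have "\<not> s 3 \<subseteq> e1" using in_e1_iff[OF xy] by auto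
  then have "rad V (s 3) = Id_on V"
    using pair s_0 by (auto simp: higmanian_pair_def)
  \<comment> \<open>A pair in \<open>s 1\<close> lies in \<open>e0\<close>, hence in the radical,
    hence on the diagonal, which is disjoint from \<open>s 1\<close>.\<close>
  moreover obtain x y where xy: "(x, y) \<in> s 1" using basis_nonempty[of "s 1"] by force
  ultimately have "(x, y) \<in> s 0" using s_0 by blast
  then show False using s_unique[OF xy, of 0] by simp
qed

text \<open>This is the equidistribution of \<open>s i\<close> over classes. By
  \<open>rad_witness\<close> some \<open>x\<close> is in relation \<open>s 3\<close> to
  \<open>y\<close> and \<open>s 4\<close> to \<open>z\<close> with \<open>y\<close> and
  \<open>z\<close> in one \<open>e0\<close> class. Counting the \<open>s i\<close> partners of
  \<open>x\<close> in the common \<open>e0\<close> class, and in the common \<open>e1\<close> class,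
  from both \<open>y\<close> and \<open>z\<close> gives equal sums; their difference is the second
  equation.\<close>

lemma p_parabolic:
  assumes "i \<le> 4"
  shows "p i 0 3 + p i 1 3 = p i 0 4 + p i 1 4" "p i 2 3 = p i 2 4"
proof -
  obtain x y z where xyz: "(x, y) \<in> s 3" "(y, z) \<in> s 1" "(x, z) \<in> s 4"
    using rad_witness by metis
  have im: "e0 `` {y} = e0 `` {z}" "e1 `` {y} = e1 `` {z}"
    using xyz equiv_e0 equiv_e1 by (auto simp del: Un_iff intro!: equiv_class_eq)
  have dist: "s 0 \<noteq> s 1" "s 0 \<noteq> s 2" "s 1 \<noteq> s 2"
    using inj_onD[OF inj_s, of 0 1] inj_onD[OF inj_s, of 0 2] inj_onD[OF inj_s, of 1 2] by auto
  have "\<Union>{s 0, s 1} = e0" "\<Union>{s 0, s 1, s 2} = e1" by auto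
  then have "(\<Sum>r\<in>{s 0, s 1}. intersection_number (s i) r (s 3)) =
      (\<Sum>r\<in>{s 0, s 1}. intersection_number (s i) r (s 4))"
    "(\<Sum>r\<in>{s 0, s 1, s 2}. intersection_number (s i) r (s 3)) =
      (\<Sum>r\<in>{s 0, s 1, s 2}. intersection_number (s i) r (s 4))"
    using card_Image_Int_Image[of "s i" "{s 0, s 1}" "s 3" x y]
      card_Image_Int_Image[of "s i" "{s 0, s 1}" "s 4" x z]
      card_Image_Int_Image[of "s i" "{s 0, s 1, s 2}" "s 3" x y]
      card_Image_Int_Image[of "s i" "{s 0, s 1, s 2}" "s 4" x z] xyz im assms
    by simp_all
  then show "p i 0 3 + p i 1 3 = p i 0 4 + p i 1 4" "p i 2 3 = p i 2 4"
    using dist by (simp_all flip: of_nat_add)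
qed

section \<open>Explicit intersection numbers\<close>

lemma p_221: "p 2 2 1 = n 2"
proof -
  \<comment> \<open>All \<open>s 1\<close> partners of one end of an \<open>s 2\<close> pair are in
    relation \<open>s 2\<close> to the other end.\<close>
  have "p 1 2 2 = n 1"
    using p_sum[of 1 2] by (simp add: p_0 p_eq_0)
  then show ?thesis using p_rotate[of 1 2 2] p_rotate[of 2 2 1] n_pos[of 1] by simp
qed

text \<open>The \<open>s 2\<close> partners of one end of an \<open>s 2\<close> pair comprise the
  other end itself, the \<open>n 1\<close> partners of that end in \<open>s 1\<close>, and the
  vertices counted here.\<close>

lemma p_222: "p 2 2 2 = n 2 - n 1 - 1"
proof -
  have "p 1 2 2 = n 1"
    using p_sum[of 1 2] by (simp add: p_0 p_eq_0)
  then show ?thesis using p_sum[of 2 2] p_commute[of 1 2 2] by (simp add: p_0 p_eq_0)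
qed

text \<open>By \<open>p_parabolic\<close> the values at \<open>s 3\<close> and \<open>s 4\<close>
  agree. Weighting them by \<open>n 3\<close> and \<open>n 4\<close> and rotating the triangles
  determines the common value.\<close>

lemma p_2i:
  assumes "i \<in> {3, 4}"
  shows "p 2 i 3 = n 2 * n i / (n 3 + n 4)" "p 2 i 4 = n 2 * n i / (n 3 + n 4)"
proof -
  have i: "i \<le> 4" using assms by auto
  have "n 3 * p 2 i 3 + n 4 * p 2 i 4 = n i * (p 2 3 i + p 2 4 i)"
    using p_rotate[of i 2 3] p_rotate[of i 2 4] p_commute i by (simp add: distrib_left)
  also have "p 2 3 i + p 2 4 i = n 2"
    using p_sum[of 2 i] assms by (auto simp: p_0 p_eq_0)
  finally have "(n 3 + n 4) * p 2 i 3 = n 2 * n i"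
    using p_parabolic(2)[of i] p_commute[of 2 i] i by (simp add: algebra_simps)
  then show "p 2 i 3 = n 2 * n i / (n 3 + n 4)" "p 2 i 4 = n 2 * n i / (n 3 + n 4)"
    using p_parabolic(2)[of i] p_commute[of 2 i] i n_pos[of 3] n_pos[of 4]
    by (simp_all add: field_simps)
qed

text \<open>The argument of \<open>p_2i\<close> is applied to \<open>e0\<close> instead of
  \<open>s 2\<close>. The diagonal contributes 1 at index \<open>i\<close> only, so
  \<open>p 1 i i\<close> is one less than the value at the other index; hence the final
  \<open>- 1\<close>.\<close>

lemma p_1ii:
  assumes "i \<in> {3, 4}"
  shows "p 1 i i = (n 1 + 1) * n i / (n 3 + n 4) - 1"
proof -
  have i: "i \<le> 4" using assms by auto
  have "n 3 * p 1 i 3 + n 4 * p 1 i 4 = n i * (p 1 3 i + p 1 4 i)"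
    using p_rotate[of i 1 3] p_rotate[of i 1 4] p_commute i by (simp add: distrib_left)
  also have "p 1 3 i + p 1 4 i = n 1"
    using p_sum[of 1 i] assms by (auto simp: p_0 p_eq_0)
  finally have eq: "n 3 * p 1 i 3 + n 4 * p 1 i 4 = n i * n 1" .
  have "(n 3 + n 4) * (p 1 i i + 1) = (n 1 + 1) * n i"
  proof (cases "i = 3")
    case True
    then have "p 1 i 4 = p 1 i 3 + 1"
      using p_parabolic(1)[of 3] p_commute[of 1 3 3] p_commute[of 1 3 4] by (simp add: p_0)
    then show ?thesis using eq True by (simp add: algebra_simps)
  next
    case False
    then have i4: "i = 4" using assms by simp
    then have "p 1 i 3 = p 1 i 4 + 1"
      using p_parabolic(1)[of 4] p_commute[of 1 4 3] p_commute[of 1 4 4] by (simp add: p_0)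
    then show ?thesis using eq i4 by (simp add: algebra_simps)
  qed
  then show ?thesis
    using n_pos[of 3] n_pos[of 4] by (simp add: field_simps)
qed

lemma p_ii1:
  assumes "i \<in> {3, 4}"
  shows "p i i 1 = n i * ((n 1 + 1) * n i / (n 3 + n 4) - 1) / n 1"
proof -
  have "n 1 * p i i 1 = n i * p 1 i i"
    using p_rotate[of i i 1] p_commute[of i 1 i] assms by auto
  then show ?thesis using n_pos[of 1] unfolding p_1ii[OF assms] by (simp add: eq_divide_eq ac_simps)
qed

lemma p_ii2:
  assumes "i \<in> {3, 4}"
  shows "p i i 2 = n i ^ 2 / (n 3 + n 4)"
proof -
  have "n 2 * p i i 2 = n i * p 2 i i"
    using p_rotate[of i i 2] p_commute[of i 2 i] assms by auto
  also have "p 2 i i = n 2 * n i / (n 3 + n 4)"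
    using p_2i[OF assms] assms by auto
  finally have "n 2 * p i i 2 = n 2 * (n i ^ 2 / (n 3 + n 4))"
    by (simp add: power2_eq_square ac_simps)
  then show ?thesis using n_pos[of 2] by (simp del: times_divide_eq_right)
qed

text \<open>Walks of length two in \<open>s i\<close> from a fixed vertex are sorted by the relation
  between their ends; the term \<open>n i\<close> counts those that return.\<close>

lemma p_ii_sum:
  assumes "i \<in> {3, 4}"
  shows "n i + n 1 * p i i 1 + n 2 * p i i 2 + n 3 * p i i 3 + n 4 * p i i 4 = n i ^ 2"
proof -
  have i: "i \<le> 4" using assms by auto
  have "n i * (p i 0 i + p i 1 i + p i 2 i + p i 3 i + p i 4 i) = n i * n i"
    using p_sum[of i i] i by simp
  then show ?thesis
    using p_rotate[of i i 1] p_rotate[of i i 2] p_rotate[of i i 3] p_rotate[of i i 4] i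
    by (simp add: p_0 distrib_left power2_eq_square)
qed

text \<open>Summed over \<open>k\<close>, the numbers \<open>p j k 3\<close> and
  \<open>p j k 4\<close> both give \<open>n j\<close>, and \<open>p_parabolic\<close> cancels the
  terms with \<open>k \<le> 2\<close>. The cases \<open>j = 3\<close> and \<open>j = 4\<close> then
  tie both differences in question to the same mixed one, \<open>p 3 4 3 - p 3 4 4\<close>.\<close>

lemma p_ii_const_iff:
  assumes "i \<in> {3, 4}"
  shows "p i i 3 = p i i 4 \<longleftrightarrow> p 3 3 3 = p 3 3 4"
proof -
  have "p j 3 3 + p j 4 3 = p j 3 4 + p j 4 4" if "j \<le> 4" for j
    using p_sum[of j 3] p_sum[of j 4] p_parabolic[OF that] that by simp
  from this[of 3] this[of 4] show ?thesis
    using assms p_commute[of 3 4 3] p_commute[of 3 4 4] by auto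
qed

end

section \<open>The graph with edge set \<open>s 2 \<union> s i\<close>\<close>

text \<open>The variables \<open>u\<close>, \<open>w\<close>, \<open>x\<close>, \<open>y\<close>
  stand for \<open>n 1\<close>, \<open>n 2\<close>, \<open>n i\<close>, \<open>n (7 - i)\<close>,
  and the left equation compares \<open>lam 1\<close> with \<open>lam 2\<close>. In both equations
  the difference of the sides is a nonzero multiple of \<open>d\<close>.\<close>

lemma class_condition_A:
  fixes u w x y :: real
  assumes "u > 0" "x > 0" "y > 0"
  shows "w + x * ((u + 1) * x / (x + y) - 1) / u = w - u - 1 + x\<^sup>2 / (x + y) \<longleftrightarrow>
    1 / x + 1 / y = 1 / u - 1 / (u + 1)"
proof -
  define N v where "N = x + y" and "v = u + 1"
  define d where "d = u * v * N - x * y"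
  have nz: "N \<noteq> 0" "u \<noteq> 0" "v \<noteq> 0" "x \<noteq> 0" "y \<noteq> 0"
    using assms by (auto simp: N_def v_def)
  have "w + x * (v * x / N - 1) / u - (w - v + x\<^sup>2 / N) = (x\<^sup>2 * (v - u) + u * v * N - x * N) / (u * N)"
    using nz by (simp add: field_simps power2_eq_square)
  also have "x\<^sup>2 * (v - u) + u * v * N - x * N = d"
    unfolding d_def N_def v_def by (simp add: algebra_simps power2_eq_square)
  finally have "w + x * (v * x / N - 1) / u - (w - v + x\<^sup>2 / N) = d / (u * N)" .
  moreover have "1 / x + 1 / y - (1 / u - 1 / v) = d / (x * y * u * v)"
  proof -
    have eqs: "1 / x + 1 / y = N / (x * y)" "1 / u - 1 / v = 1 / (u * v)"
      using nz by (simp_all add: N_def v_def field_simps)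
    show ?thesis unfolding d_def eqs using nz by (simp add: field_simps)
  qed
  moreover have "d / (u * N) = 0 \<longleftrightarrow> d / (x * y * u * v) = 0"
    using nz by simp
  ultimately have "w + x * (v * x / N - 1) / u = w - v + x\<^sup>2 / N \<longleftrightarrow> 1 / x + 1 / y = 1 / u - 1 / v"
    by (metis eq_iff_diff_eq_0)
  then show ?thesis unfolding N_def v_def by (simp add: diff_diff_eq)
qed

text \<open>Here \<mu> stands for \<open>p i i 3\<close>, and the last hypothesis is the walk count
  \<open>p_ii_sum\<close> in the case \<open>p i i 3 = p i i 4\<close>. The left equation compares
  \<open>lam 2\<close> with \<open>lam 3\<close>; again both differences are nonzero multiples of
  \<open>d\<close>.\<close>

lemma class_condition_B:
  fixes u w x y \<mu> :: real
  assumes "u > 0" "x > 0" "y > 0"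
    and "(x + y) * \<mu> = x\<^sup>2 - (u + 1 + w) * x\<^sup>2 / (x + y)"
  shows "w - u - 1 + x\<^sup>2 / (x + y) = 2 * w * x / (x + y) + \<mu> \<longleftrightarrow>
    w / (u + 1) - 2 * x / y = 1"
proof -
  define d where "d = w * y - (u + 1) * (y + 2 * x)"
  define N where "N = x + y"
  have nz: "N \<noteq> 0" "u + 1 \<noteq> 0" "y \<noteq> 0" using assms by (auto simp: N_def)
  have \<mu>: "\<mu> = (x\<^sup>2 - (u + 1 + w) * x\<^sup>2 / N) / N"
    using assms(4) nz by (simp add: N_def eq_divide_eq mult.commute)
  have "N\<^sup>2 * (w - u - 1 + x\<^sup>2 / N - (2 * w * x / N + \<mu>)) = y * d"
  proof -
    have "N\<^sup>2 * (w - u - 1 + x\<^sup>2 / N - (2 * w * x / N + \<mu>)) =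
        N\<^sup>2 * (w - u - 1) + x\<^sup>2 * N - 2 * w * x * N - (x\<^sup>2 * N - (u + 1 + w) * x\<^sup>2)"
      unfolding \<mu> using nz by (simp add: field_simps power2_eq_square)
    also have "\<dots> = y * d"
      unfolding d_def N_def by (simp add: algebra_simps power2_eq_square)
    finally show ?thesis .
  qed
  then have "w - u - 1 + x\<^sup>2 / N - (2 * w * x / N + \<mu>) = 0 \<longleftrightarrow> d = 0"
    using nz by (metis mult_eq_0_iff power_not_zero)
  moreover have "w / v - 2 * x / y - 1 = (w * y - v * (y + 2 * x)) / (v * y)" if "v \<noteq> 0" for v
    using that nz by (simp add: field_simps)
  then have "w / (u + 1) - 2 * x / y - 1 = d / ((u + 1) * y)"
    unfolding d_def using nz by blast
  then have "w / (u + 1) - 2 * x / y - 1 = 0 \<longleftrightarrow> d = 0"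
    using nz by simp
  ultimately show ?thesis unfolding N_def by linarith
qed

locale higmanian_graph = higmanian_scheme +
  fixes i :: nat
  assumes i: "i \<in> {3, 4}"
begin

section \<open>Common neighbours and degrees\<close>

definition G :: "'a pair_pre_digraph"
  where "G = \<lparr>pverts = V, parcs = s 2 \<union> s i\<rparr>"

definition lam :: "nat \<Rightarrow> nat"
  where "lam l = intersection_number (s 2) (s 2) (s l) + 2 * intersection_number (s 2) (s i) (s l) +
    intersection_number (s i) (s i) (s l)"

lemma i_le [simp]: "i \<le> 4"
  using i by auto

text \<open>Common neighbours are sorted by their relations to \<open>x\<close> and
  \<open>y\<close>. The two mixed counts agree by commutativity, whence the factor 2 in
  \<open>lam\<close>.\<close>

lemma card_common_neighbours:
  assumes "(x, y) \<in> s l" "l \<le> 4"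
  shows "card (common_neighbours G x y) = lam l"
proof -
  have ne: "s 2 \<noteq> s i" using inj_onD[OF inj_s, of 2 i] i by auto
  let ?E = "\<Union>{s 2, s i}"
  have "common_neighbours G x y = (s 2 `` {x} \<inter> ?E `` {y}) \<union> (s i `` {x} \<inter> ?E `` {y})"
    by (auto simp: common_neighbours_def G_def)
  also have "card \<dots> = card (s 2 `` {x} \<inter> ?E `` {y}) + card (s i `` {x} \<inter> ?E `` {y})"
  proof (rule card_Un_disjoint)
    show "finite (s 2 `` {x} \<inter> ?E `` {y})" "finite (s i `` {x} \<inter> ?E `` {y})"
      using finite_Image[of "s 2" x] finite_Image[of "s i" x] by auto
    show "s 2 `` {x} \<inter> ?E `` {y} \<inter> (s i `` {x} \<inter> ?E `` {y}) = {}"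
      using s_unique[of x _ 2 i] i by auto
  qed
  also have "\<dots> = lam l"
    using card_Image_Int_Image[of "s 2" "{s 2, s i}" "s l" x y]
      card_Image_Int_Image[of "s i" "{s 2, s i}" "s l" x y]
      intersection_number_commute[of "s i" "s 2" "s l"] assms ne
    by (simp add: lam_def)
  finally show ?thesis .
qed

lemma lam_1: "real (lam 1) = n 2 + n i * ((n 1 + 1) * n i / (n 3 + n 4) - 1) / n 1"
proof -
  have "p 2 i 1 = 0" using i by (intro p_eq_0) auto
  then show ?thesis using p_221 p_ii1[OF i] by (simp add: lam_def)
qed

lemma lam_2: "real (lam 2) = n 2 - n 1 - 1 + n i ^ 2 / (n 3 + n 4)"
proof -
  have "p 2 i 2 = 0" using i by (intro p_eq_0) auto
  then show ?thesis using p_222 p_ii2[OF i] by (simp add: lam_def)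
qed

lemma lam_3: "real (lam 3) = 2 * n 2 * n i / (n 3 + n 4) + p i i 3"
  and lam_4: "real (lam 4) = 2 * n 2 * n i / (n 3 + n 4) + p i i 4"
proof -
  have "p 2 2 3 = 0" "p 2 2 4 = 0" by (intro p_eq_0; simp)+
  then show "real (lam 3) = 2 * n 2 * n i / (n 3 + n 4) + p i i 3"
    "real (lam 4) = 2 * n 2 * n i / (n 3 + n 4) + p i i 4"
    using p_2i[OF i] by (simp_all add: lam_def)
qed

lemma lam_3_eq_4_iff:
  "lam 3 = lam 4 \<longleftrightarrow> intersection_number (s 3) (s 3) (s 3) = intersection_number (s 3) (s 3) (s 4)"
  using lam_3 lam_4 p_ii_const_iff[OF i] by (metis add_left_cancel of_nat_eq_iff)

text \<open>The index \<open>7 - i\<close> is the element of \<open>{3, 4}\<close> other than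
  \<open>i\<close>.\<close>

lemma n_complement: "n 3 + n 4 = n i + n (7 - i)"
  using i by auto

text \<open>Condition (A) is symmetric in \<open>n 3\<close> and \<open>n 4\<close>, so it can be
  read with \<open>n i\<close> and \<open>n (7 - i)\<close>.\<close>

lemma lam_1_eq_2_iff: "lam 1 = lam 2 \<longleftrightarrow> 1 / n 3 + 1 / n 4 = 1 / n 1 - 1 / (n 1 + 1)"
proof -
  have "1 / n 3 + 1 / n 4 = 1 / n i + 1 / n (7 - i)"
    using i by auto
  moreover have "7 - i \<le> 4" using i by auto
  ultimately show ?thesis
    using class_condition_A[of "n 1" "n i" "n (7 - i)" "n 2"] n_pos lam_1 lam_2
    unfolding n_complement by (metis i_le of_nat_eq_iff one_le_numeral)
qed

text \<open>Equality at 3 and 4 leaves a single unknown in \<open>p_ii_sum\<close>, which therefore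
  determines \<open>p i i 3\<close>.\<close>

lemma lam_2_eq_3_iff:
  assumes "lam 3 = lam 4"
  shows "lam 2 = lam 3 \<longleftrightarrow> n 2 / (n 1 + 1) - 2 * n i / n (7 - i) = 1"
proof -
  have le: "7 - i \<le> 4" using i by auto
  have "p i i 3 = p i i 4" using assms lam_3 lam_4 by simp
  then have "n i + n i * ((n 1 + 1) * n i / (n 3 + n 4) - 1) + n 2 * (n i ^ 2 / (n 3 + n 4)) +
      (n 3 + n 4) * p i i 3 = n i ^ 2"
    using p_ii_sum[OF i] n_pos[of 1] unfolding p_ii1[OF i] p_ii2[OF i] by (simp add: distrib_right)
  then have "(n 3 + n 4) * p i i 3 = n i ^ 2 - (n 1 + 1 + n 2) * n i ^ 2 / (n 3 + n 4)"
    by (simp add: algebra_simps add_divide_distrib power2_eq_square)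
  then have "n 2 - n 1 - 1 + n i ^ 2 / (n 3 + n 4) = 2 * n 2 * n i / (n 3 + n 4) + p i i 3 \<longleftrightarrow>
      n 2 / (n 1 + 1) - 2 * n i / n (7 - i) = 1"
    using class_condition_B[of "n 1" "n i" "n (7 - i)" "p i i 3" "n 2"] n_pos le
    unfolding n_complement by simp
  then show ?thesis using lam_2 lam_3 by (metis of_nat_eq_iff)
qed

lemma pair_graph_G: "pair_graph G"
proof
  fix e assume "e \<in> parcs G"
  then have "\<exists>x y l. e = (x, y) \<and> (x, y) \<in> s l \<and> 2 \<le> l \<and> l \<le> 4"
    using i by (cases e) (auto simp: G_def)
  then obtain x y l where l: "e = (x, y)" "(x, y) \<in> s l" "2 \<le> l" "l \<le> 4" by blast
  have "x \<in> V" "y \<in> V" using l in_V[of "s l"] by auto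
  moreover have "x \<noteq> y" using l s_unique[of x y l 0] \<open>x \<in> V\<close> by (auto simp: s_0)
  ultimately show "fst e \<in> pverts G" "snd e \<in> pverts G" "fst e \<noteq> snd e"
    using l by (auto simp: G_def)
next
  show "finite (pverts G)" "finite (parcs G)"
    using finite_V finite_basis by (auto simp: G_def)
next
  show "symmetric G"
    using s_sym by (auto simp: G_def symmetric_def intro!: symI)
qed

lemma out_degree_G:
  assumes "x \<in> V"
  shows "out_degree (with_proj G) x = valency V (s 2) + valency V (s i)"
proof -
  have "out_arcs (with_proj G) x = Pair x ` (s 2 `` {x} \<union> s i `` {x})"
    by (auto simp: out_arcs_def G_def)
  then have "out_degree (with_proj G) x = card (s 2 `` {x} \<union> s i `` {x})"
    by (simp add: out_degree_def card_image inj_on_def)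
  also have "\<dots> = card (s 2 `` {x}) + card (s i `` {x})"
    using s_unique[of x _ 2 i] i by (intro card_Un_disjoint finite_Image) auto
  finally show ?thesis using valency_eq assms by simp
qed

section \<open>Divisible designs from the parabolics\<close>

text \<open>Here \<open>e\<close> is the union of \<open>s 0\<close> up to \<open>s h\<close>: it is
  \<open>e0\<close> for \<open>h = 1\<close> and \<open>e1\<close> for \<open>h = 2\<close>. The
  condition on \<open>l1\<close> starts at index 1 because it concerns distinct vertices.\<close>

lemma divisible_design_quotient:
  assumes "equiv V e" and "h \<in> {1, 2}"
    and in_e: "\<And>x y l. (x, y) \<in> s l \<Longrightarrow> l \<le> 4 \<Longrightarrow> (x, y) \<in> e \<longleftrightarrow> l \<le> h"
    and l1: "\<And>l. 1 \<le> l \<Longrightarrow> l \<le> h \<Longrightarrow> lam l = l1"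
    and l2: "\<And>l. h < l \<Longrightarrow> l \<le> 4 \<Longrightarrow> lam l = l2"
  shows "\<exists>v k m q. divisible_design G (V // e) v k l1 l2 m q \<and> m > 1 \<and> q > 1"
proof -
  have part: "partition_on V (V // e)" using partition_on_quotient assms(1) by blast
  have eV: "e \<subseteq> V \<times> V" using assms(1) by (auto simp: equiv_def refl_on_def)
  define q where "q = (\<Sum>j\<le>h. valency V (s j))"
  have card_class: "card (e `` {x}) = q" if "x \<in> V" for x
  proof -
    have "e `` {x} = (\<Union>j\<in>{..h}. s j `` {x})"
    proof (intro set_eqI iffI)
      fix y assume y: "y \<in> e `` {x}"
      then obtain l where "l \<le> 4" "(x, y) \<in> s l" using s_exists[of x y] eV by blast
      then show "y \<in> (\<Union>j\<in>{..h}. s j `` {x})" using in_e y by auto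
    next
      fix y assume "y \<in> (\<Union>j\<in>{..h}. s j `` {x})"
      then obtain l where "l \<le> h" "(x, y) \<in> s l" by auto
      then show "y \<in> e `` {x}" using in_e[of x y l] assms(2) by auto
    qed
    also have "card \<dots> = (\<Sum>j\<le>h. card (s j `` {x}))"
    proof (rule card_UN_disjoint)
      show "\<forall>j\<in>{..h}. finite (s j `` {x})" using assms(2) finite_Image by auto
      show "\<forall>j\<in>{..h}. \<forall>k\<in>{..h}. j \<noteq> k \<longrightarrow> s j `` {x} \<inter> s k `` {x} = {}"
      proof (intro ballI impI)
        fix j k assume "j \<in> {..h}" "k \<in> {..h}" "j \<noteq> k"
        then have "j \<le> 4" "k \<le> 4" using assms(2) by auto
        then show "s j `` {x} \<inter> s k `` {x} = {}" using s_unique[of x _ j k] \<open>j \<noteq> k\<close> by blast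
      qed
    qed simp
    also have "\<dots> = q"
      unfolding q_def using assms(2) that by (intro sum.cong refl valency_eq s_mem) auto
    finally show ?thesis .
  qed
  have "q > 1"
  proof -
    have "q \<ge> (\<Sum>j\<in>{0, 1}. valency V (s j))"
      unfolding q_def using assms(2) by (intro sum_mono2) auto
    then show ?thesis using valency_pos[of "s 0"] valency_pos[of "s 1"] by simp
  qed
  moreover have "card (V // e) > 1"
  proof -
    \<comment> \<open>As \<open>h \<le> 2\<close>, the ends of an \<open>s 3\<close> pair lie in
      different classes.\<close>
    obtain x y where "(x, y) \<in> s 3" using basis_nonempty[of "s 3"] by force
    then have xy: "(x, y) \<in> s 3" "x \<in> V" "y \<in> V" using in_V[of "s 3" x y] by auto
    then have "(x, y) \<notin> e" using in_e[of x y 3] assms(2) by auto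
    then have ne: "e `` {x} \<noteq> e `` {y}" using eq_equiv_class_iff[OF assms(1)] xy by auto
    have "{e `` {x}, e `` {y}} \<subseteq> V // e" using xy by (auto intro: quotientI)
    then have "card {e `` {x}, e `` {y}} \<le> card (V // e)"
      using finite_V eV by (intro card_mono finite_quotient) auto
    then show ?thesis using ne by simp
  qed
  moreover have "card (common_neighbours G x y) = l1"
    if "C \<in> V // e" "x \<in> C" "y \<in> C" "x \<noteq> y" for C x y
  proof -
    have "(x, y) \<in> e" using quotient_eq_iff[OF assms(1)] that by blast
    moreover from this obtain l where l: "l \<le> 4" "(x, y) \<in> s l" using s_exists[of x y] eV by blast
    moreover have "l \<noteq> 0" using l that s_0 by (metis Id_onE Pair_inject)
    ultimately show ?thesis using in_e card_common_neighbours l1[of l] by auto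
  qed
  moreover have "card (common_neighbours G x y) = l2"
    if "C \<in> V // e" "D \<in> V // e" "C \<noteq> D" "x \<in> C" "y \<in> D" for C D x y
  proof -
    have "(x, y) \<notin> e" using quotient_eq_iff[OF assms(1)] that by blast
    moreover have "x \<in> V" "y \<in> V" using that part by (auto simp: partition_on_def)
    then obtain l where l: "l \<le> 4" "(x, y) \<in> s l" using s_exists by metis
    ultimately show ?thesis using in_e card_common_neighbours l2[of l] by auto
  qed
  moreover have "card C = q" if "C \<in> V // e" for C
    using that card_class by (auto elim: quotientE)
  ultimately have "divisible_design G (V // e) (card V) (valency V (s 2) + valency V (s i)) l1 l2
      (card (V // e)) q \<and> card (V // e) > 1 \<and> q > 1"
    unfolding divisible_design_def using pair_graph_G out_degree_G part by (auto simp: G_def)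
  then show ?thesis by blast
qed

lemma divisible_design_e0:
  assumes "lam 2 = lam 3" "lam 3 = lam 4"
  shows "\<exists>v k m q. divisible_design G (V // e0) v k (lam 1) (lam 2) m q \<and> m > 1 \<and> q > 1"
  using equiv_e0 in_e0_iff assms
  by (intro divisible_design_quotient[where h = 1])
    (auto simp: le_Suc_eq less_Suc_eq_le numeral_eq_Suc)

lemma divisible_design_e1:
  assumes "lam 1 = lam 2" "lam 3 = lam 4"
  shows "\<exists>v k m q. divisible_design G (V // e1) v k (lam 1) (lam 3) m q \<and> m > 1 \<and> q > 1"
  using equiv_e1 in_e1_iff assms
  by (intro divisible_design_quotient[where h = 2])
    (auto simp: le_Suc_eq less_Suc_eq_le numeral_eq_Suc)

section \<open>Which partitions are canonical\<close>

text \<open>In this degenerate case any two distinct vertices have equally many common neighbours,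
  and the classes of \<open>e0\<close> and those of \<open>e1\<close> both form a canonical
  partition.\<close>

definition lam_const :: bool
  where "lam_const \<longleftrightarrow> lam 1 = lam 2 \<and> lam 2 = lam 3 \<and> lam 3 = lam 4"

lemma lam_constD: "lam_const \<Longrightarrow> l \<in> {1..4} \<Longrightarrow> lam l = lam 1"
  by (auto simp: lam_const_def le_Suc_eq numeral_eq_Suc)

lemma divisible_design_lam:
  assumes "divisible_design G P v k l1 l2 m q" "(x, y) \<in> s l" "l \<in> {1..4}"
  shows "lam l = (if \<exists>C\<in>P. x \<in> C \<and> y \<in> C then l1 else l2)"
proof -
  have xy: "x \<in> V" "y \<in> V" using in_V[of "s l"] assms by auto
  have "x \<noteq> y" using assms s_unique[of x y l 0] xy by (auto simp: s_0)
  moreover have "\<Union>P = V" using assms(1) by (auto simp: divisible_design_def partition_on_def G_def)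
  then obtain C D where "C \<in> P" "D \<in> P" "x \<in> C" "y \<in> D" using xy by blast
  ultimately show ?thesis
    using assms card_common_neighbours[OF assms(2)] unfolding divisible_design_def
    by (metis atLeastAtMost_iff)
qed

text \<open>If \<open>l1 \<noteq> l2\<close>, then lying in a common class depends only on the basis relation containing the
  pair, so this equivalence is one of the four parabolics.\<close>

lemma canonical_partition_cases:
  assumes dd: "divisible_design G P v k l1 l2 m q"
  shows "lam_const \<or>
    P = V // e0 \<and> lam 1 \<noteq> lam 2 \<and> lam 2 = lam 3 \<and> lam 3 = lam 4 \<or>
    P = V // e1 \<and> lam 1 = lam 2 \<and> lam 2 \<noteq> lam 3 \<and> lam 3 = lam 4"
proof -
  define E where "E = {(x, y). \<exists>C\<in>P. x \<in> C \<and> y \<in> C}"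
  have part: "partition_on V P" using dd by (auto simp: divisible_design_def G_def)
  have equiv: "equiv V E" and P: "V // E = P"
    using equiv_partition_on[OF part] partition_on_eq_quotient[OF part] by (auto simp: E_def)
  have EV: "E \<subseteq> V \<times> V" using equiv by (auto simp: equiv_def refl_on_def)
  have lam: "lam l = (if (x, y) \<in> E then l1 else l2)" if "(x, y) \<in> s l" "l \<in> {1..4}" for x y l
    using divisible_design_lam[OF dd that] by (simp add: E_def)
  have lam_in: "lam l \<in> {l1, l2}" if "l \<in> {1..4}" for l
  proof -
    obtain x y where "(x, y) \<in> s l" using basis_nonempty[of "s l"] \<open>l \<in> {1..4}\<close> by force
    then show ?thesis using lam[of x y l] that by auto
  qed
  show ?thesis
  proof (cases "l1 = l2")
    case True
    then show ?thesis using lam_in by (simp add: lam_const_def)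
  next
    case False
    have E_iff: "(x, y) \<in> E \<longleftrightarrow> lam l = l1" if "(x, y) \<in> s l" "l \<in> {1..4}" for x y l
      using lam[OF that] False by auto
    \<comment> \<open>Since \<open>E\<close> is transitive, the relations on which
      \<open>lam\<close> takes the value \<open>l1\<close> are closed under composition.\<close>
    have triangle: "lam l = l1"
      if jkl: "p j k l > 0" "lam j = l1" "lam k = l1" "j \<in> {1..4}" "k \<in> {1..4}" "l \<in> {1..4}" for j k l
    proof -
      obtain x y where xy: "(x, y) \<in> s l" using basis_nonempty[of "s l"] \<open>l \<in> {1..4}\<close> by force
      then obtain z where "(x, z) \<in> s j" "(z, y) \<in> s k"
        using intersection_number_pos_iff[of "s j" "s k" "s l" x y] jkl by auto
      then have "(x, z) \<in> E" "(z, y) \<in> E" using E_iff that by auto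
      then have "(x, y) \<in> E" using equiv by (meson equivE transE)
      then show ?thesis using E_iff xy that by auto
    qed
    have pos: "p 2 2 1 > 0" "p 3 3 2 > 0" "p 4 4 2 > 0"
      using p_221 p_ii2[of 3] p_ii2[of 4] n_pos[of 2] n_pos[of 3] n_pos[of 4] by auto
    have pos': "p 3 1 4 > 0" "p 4 1 3 > 0"
    proof -
      obtain x y z where "(x, y) \<in> s 3" "(y, z) \<in> s 1" "(x, z) \<in> s 4" using rad_witness by blast
      then show "p 3 1 4 > 0" "p 4 1 3 > 0"
        using intersection_number_pos_iff[of "s 3" "s 1" "s 4" x z] s_sym[of 1 y z]
          intersection_number_pos_iff[of "s 4" "s 1" "s 3" x y] by auto
    qed
    \<comment> \<open>These implications leave only the index sets \<open>{}\<close>,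
      \<open>{1}\<close>, \<open>{1, 2}\<close> and \<open>{1..4}\<close> for the value
      \<open>l1\<close>. In the first and the last, \<open>lam\<close> is constant; the other two
      give \<open>e0\<close> and \<open>e1\<close>.\<close>
    have up: "lam 2 = l1 \<Longrightarrow> lam 1 = l1" "lam 3 = l1 \<Longrightarrow> lam 2 = l1" "lam 4 = l1 \<Longrightarrow> lam 2 = l1"
      "lam 3 = l1 \<Longrightarrow> lam 1 = l1 \<Longrightarrow> lam 4 = l1" "lam 4 = l1 \<Longrightarrow> lam 1 = l1 \<Longrightarrow> lam 3 = l1"
      using triangle[OF pos(1)] triangle[OF pos(2)] triangle[OF pos(3)] triangle[OF pos'(1)]
        triangle[OF pos'(2)] by auto
    \<comment> \<open>Apart from the diagonal, \<open>E\<close> is the union of those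
      \<open>s l\<close> with \<open>lam l = l1\<close>.\<close>
    have E_eq: "E = e" if e: "equiv V e" "h \<in> {1, 2}"
        "\<And>x y l. (x, y) \<in> s l \<Longrightarrow> l \<le> 4 \<Longrightarrow> (x, y) \<in> e \<longleftrightarrow> l \<le> h"
        "\<And>l. l \<in> {1..4} \<Longrightarrow> lam l = l1 \<longleftrightarrow> l \<le> h" for e h
    proof -
      have "(x, y) \<in> E \<longleftrightarrow> (x, y) \<in> e" if "x \<in> V" "y \<in> V" for x y
      proof -
        obtain l where l: "l \<le> 4" "(x, y) \<in> s l" using s_exists[of x y] \<open>x \<in> V\<close> \<open>y \<in> V\<close> by metis
        show ?thesis
        proof (cases "l = 0")
          case True
          then have "x = y" using l s_0 by auto
          then show ?thesis using equiv e(1) \<open>x \<in> V\<close> by (meson equivE refl_onD)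
        next
          case False
          then show ?thesis using l e(3)[of x y l] e(4)[of l] E_iff[of x y l] by auto
        qed
      qed
      moreover have "e \<subseteq> V \<times> V" using e(1) by (auto simp: equiv_def refl_on_def)
      ultimately show ?thesis using EV by (intro set_eqI) (metis mem_Sigma_iff subsetD surj_pair)
    qed
    have l2: "lam l \<noteq> l1 \<Longrightarrow> lam l = l2" if "l \<in> {1..4}" for l using lam_in[OF that] by auto
    consider "lam 3 = l1" | "lam 3 \<noteq> l1" "lam 2 = l1" | "lam 3 \<noteq> l1" "lam 2 \<noteq> l1" "lam 1 = l1"
      | "lam 3 \<noteq> l1" "lam 2 \<noteq> l1" "lam 1 \<noteq> l1" by blast
    then show ?thesis
    proof cases
      case 1
      then show ?thesis using up by (simp add: lam_const_def)
    next
      case 2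
      then have *: "lam 1 = l1" "lam 3 = l2" "lam 4 = l2" using up l2[of 3] l2[of 4] by auto
      have "lam l = l1 \<longleftrightarrow> l \<le> 2" if "l \<in> {1..4}" for l
      proof -
        have "l = 1 \<or> l = 2 \<or> l = 3 \<or> l = 4" using that by auto
        then show ?thesis using * 2 False by auto
      qed
      then have "E = e1" using equiv_e1 in_e1_iff by (intro E_eq[where h = 2]) auto
      then show ?thesis using P * 2 by auto
    next
      case 3
      then have *: "lam 2 = l2" "lam 3 = l2" "lam 4 = l2" using up l2[of 2] l2[of 3] l2[of 4] by auto
      have "lam l = l1 \<longleftrightarrow> l \<le> 1" if "l \<in> {1..4}" for l
      proof -
        have "l = 1 \<or> l = 2 \<or> l = 3 \<or> l = 4" using that by auto
        then show ?thesis using * 3 False by auto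
      qed
      then have "E = e0" using equiv_e0 in_e0_iff by (intro E_eq[where h = 1]) auto
      then show ?thesis using P * 3 by auto
    next
      case 4
      then have "lam 4 \<noteq> l1" using up by blast
      then have "lam 1 = l2" "lam 2 = l2" "lam 3 = l2" "lam 4 = l2"
        using 4 l2[of 1] l2[of 2] l2[of 3] l2[of 4] by simp_all
      then show ?thesis by (simp add: lam_const_def)
    qed
  qed
qed

section \<open>Criteria in terms of \<open>lam\<close>\<close>

lemma DDG_iff: "DDG G \<longleftrightarrow> lam 3 = lam 4 \<and> (lam 1 = lam 2 \<or> lam 2 = lam 3)"
  using canonical_partition_cases divisible_design_e0 divisible_design_e1
  unfolding DDG_def lam_const_def by metis

lemma canonical_partition_e0: "lam 2 = lam 3 \<Longrightarrow> lam 3 = lam 4 \<Longrightarrow> canonical_partition G (V // e0)"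
  using divisible_design_e0 unfolding canonical_partition_def by blast

lemma canonical_partition_e1: "lam 1 = lam 2 \<Longrightarrow> lam 3 = lam 4 \<Longrightarrow> canonical_partition G (V // e1)"
  using divisible_design_e1 unfolding canonical_partition_def by blast

text \<open>With \<open>m > 1\<close> and \<open>q > 1\<close> there are two distinct vertices in
  one class and two vertices in different classes. Constancy of \<open>lam\<close> would make their
  counts \<open>l1\<close> and \<open>l2\<close> equal.\<close>

lemma proper_DDG_imp_not_lam_const:
  assumes "proper_DDG G" shows "\<not> lam_const"
proof
  assume const: lam_const
  obtain P v k l1 l2 m q where dd: "divisible_design G P v k l1 l2 m q"
    and mq: "m > 1" "q > 1" "l1 \<noteq> l2"
    using assms by (auto simp: proper_DDG_def)
  have part: "partition_on V P" and cards: "card P = m" "\<And>C. C \<in> P \<Longrightarrow> card C = q"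
    using dd by (auto simp: divisible_design_def G_def)
  have lam: "lam 1 = (if \<exists>C\<in>P. x \<in> C \<and> y \<in> C then l1 else l2)"
    if "x \<in> V" "y \<in> V" "x \<noteq> y" for x y
  proof -
    obtain l where l: "l \<le> 4" "(x, y) \<in> s l" using s_exists[of x y] \<open>x \<in> V\<close> \<open>y \<in> V\<close> by metis
    then have "l \<noteq> 0" using \<open>x \<noteq> y\<close> s_0 by (metis Id_onE Pair_inject)
    then have "l \<in> {1..4}" using l by simp
    then show ?thesis using divisible_design_lam[OF dd l(2)] lam_constD[OF const] by metis
  qed
  obtain C D where CD: "C \<in> P" "D \<in> P" "C \<noteq> D"
    using cards(1) mq(1) by (metis One_nat_def card_le_Suc0_iff_eq card.infinite leD not_less_zero)
  have "\<exists>x y. x \<in> C \<and> y \<in> C \<and> x \<noteq> y"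
    using cards(2)[OF CD(1)] mq(2) by (metis One_nat_def card_le_Suc0_iff_eq card.infinite leD not_less_zero)
  then obtain x y where xy: "x \<in> C" "y \<in> C" "x \<noteq> y" by blast
  obtain z where z: "z \<in> D" using cards(2)[OF CD(2)] mq(2) by fastforce
  have V: "x \<in> V" "y \<in> V" "z \<in> V" using xy z CD part by (auto simp: partition_on_def)
  have uniq: "B = B'" if "B \<in> P" "B' \<in> P" "u \<in> B" "u \<in> B'" for B B' u
    using part that by (auto simp: partition_on_def disjoint_def)
  then have "x \<noteq> z" and "\<not> (\<exists>B\<in>P. x \<in> B \<and> z \<in> B)" using CD xy z by blast+
  then have "lam 1 = l2" using lam[OF V(1,3)] by metis
  moreover have "lam 1 = l1" using lam[OF V(1,2) xy(3)] CD xy by auto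
  ultimately show False using mq by simp
qed

text \<open>For the converse, \<open>DDG_iff\<close> and non-constancy leave two cases:
  \<open>e1\<close> with \<open>lam 1 \<noteq> lam 3\<close>, or \<open>e0\<close> with
  \<open>lam 1 \<noteq> lam 2\<close>. In each the two design constants differ.\<close>

lemma proper_DDG_iff: "proper_DDG G \<longleftrightarrow> DDG G \<and> \<not> lam_const"
proof
  assume "proper_DDG G"
  then show "DDG G \<and> \<not> lam_const"
    using proper_DDG_imp_not_lam_const unfolding proper_DDG_def DDG_def by blast
next
  assume "DDG G \<and> \<not> lam_const"
  then consider "lam 1 = lam 2" "lam 3 = lam 4" "lam 1 \<noteq> lam 3"
    | "lam 2 = lam 3" "lam 3 = lam 4" "lam 1 \<noteq> lam 2"
    by (auto simp: DDG_iff lam_const_def)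
  then show "proper_DDG G"
    using divisible_design_e0 divisible_design_e1 unfolding proper_DDG_def by cases blast+
qed

end

text \<open>If \<open>A\<close> and \<open>B\<close> both hold for a divisible design graph, the
  classes of \<open>e0\<close> and of \<open>e1\<close> are both canonical partitions; uniqueness is
  therefore stated for proper graphs.\<close>

theorem theorem1:
  fixes V :: "'a set" and S :: "'a rel set" and s :: "nat \<Rightarrow> 'a rel" and e0 e1 :: "'a rel"
    and i :: nat and \<Gamma> :: "'a pair_pre_digraph"
    and n :: "nat \<Rightarrow> real" and c :: "nat \<Rightarrow> nat \<Rightarrow> nat \<Rightarrow> nat" and A B :: bool
  assumes "higmanian V S" and "standard_ordering V S s"
    and "e0 = s 0 \<union> s 1" and "e1 = s 0 \<union> s 1 \<union> s 2"
    and "i \<in> {3, 4}"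
    and "\<Gamma> = \<lparr>pverts = V, parcs = s 2 \<union> s i\<rparr>"
    and "n = (\<lambda>j. real (valency V (s j)))"
    and "c = (\<lambda>j k l. intersection_number (s j) (s k) (s l))"
    and "A \<longleftrightarrow> 1 / n 3 + 1 / n 4 = 1 / n 1 - 1 / (n 1 + 1)"
    and "B \<longleftrightarrow> n 2 / (n 1 + 1) - 2 * n i / n (7 - i) = 1"
  shows "(DDG \<Gamma> \<longleftrightarrow> c 3 3 3 = c 3 3 4 \<and> (A \<or> B)) \<and>
    (DDG \<Gamma> \<longrightarrow>
      (A \<longrightarrow> canonical_partition \<Gamma> (V // e1) \<and>
        (proper_DDG \<Gamma> \<longrightarrow> (\<forall>P. canonical_partition \<Gamma> P \<longrightarrow> P = V // e1))) \<and>
      (B \<longrightarrow> canonical_partition \<Gamma> (V // e0) \<and>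
        (proper_DDG \<Gamma> \<longrightarrow> (\<forall>P. canonical_partition \<Gamma> P \<longrightarrow> P = V // e0))) \<and>
      (proper_DDG \<Gamma> \<longleftrightarrow> (A \<and> \<not> B) \<or> (\<not> A \<and> B)))"
proof -
  interpret H: higmanian_graph V S s i
    using assms by unfold_locales auto
  have \<Gamma>: "\<Gamma> = H.G" using assms by (simp add: H.G_def)
  have A: "A \<longleftrightarrow> H.lam 1 = H.lam 2"
    using assms H.lam_1_eq_2_iff by simp
  \<comment> \<open>The condition \<open>H.lam 3 = H.lam 4\<close> is what \<open>C\<close> provides
    from the equality of intersection numbers.\<close>
  have B: "B \<longleftrightarrow> H.lam 2 = H.lam 3" if "H.lam 3 = H.lam 4"
    using assms H.lam_2_eq_3_iff[OF that] by simp
  have C: "c 3 3 3 = c 3 3 4 \<longleftrightarrow> H.lam 3 = H.lam 4"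
    using assms H.lam_3_eq_4_iff by simp
  have ddg: "DDG \<Gamma> \<longleftrightarrow> c 3 3 3 = c 3 3 4 \<and> (A \<or> B)"
    using A B C H.DDG_iff \<Gamma> by blast
  \<comment> \<open>Properness rules out \<open>lam_const\<close>, so only the two nondegenerate
    cases of \<open>canonical_partition_cases\<close> remain.\<close>
  have unique: "P = V // e1 \<and> A \<and> \<not> B \<or> P = V // e0 \<and> \<not> A \<and> B"
    if "proper_DDG \<Gamma>" "canonical_partition \<Gamma> P" for P
    using that H.canonical_partition_cases[of P] H.proper_DDG_iff A B
    unfolding canonical_partition_def \<Gamma> assms(3,4) by blast
  have "A \<longrightarrow> canonical_partition \<Gamma> (V // e1)" "B \<longrightarrow> canonical_partition \<Gamma> (V // e0)"
    "proper_DDG \<Gamma> \<longleftrightarrow> (A \<and> \<not> B) \<or> (\<not> A \<and> B)" if "DDG \<Gamma>"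
    using that A B C ddg H.canonical_partition_e0 H.canonical_partition_e1 H.proper_DDG_iff
    unfolding \<Gamma> assms(3,4) H.lam_const_def by auto
  then show ?thesis using ddg unique by blast
qed

end
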